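(* Any (possibly randomized) PSA for $FVS(k)$ requires $\Omega(n)$ space, where $n$ is the number of vertices of the graph; this holds already for $k=0$ and, more generally, for every constant $k$.
   Context: Feedback Vertex Set $FVS(k)$: given a graph $G=(V,E)$ and an integer $k$, decide whether there is a set $V'\subseteq V$ with $|V'|\le k$ such that $G\setminus V'$ has no cycles. A PSA (parameterized streaming algorithm) is a one-pass streaming algorithm over an insertion-only stream of edges that maintains a sketch (memory) from which it answers the question for the current graph; its space is the size of this memory. *)

theory Defs
  imports "HOL-Probability.Probability"
begin

text \<open>A finite simple graph is a vertex set \<open>V\<close> together with a set of two-element
  subsets of \<open>V\<close>.\<close>

definition all_edges :: "'a set \<Rightarrow> 'a set set" where
  "all_edges V = {{u, v} | u v. u \<in> V \<and> v \<in> V \<and> u \<noteq> v}"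

definition is_cycle :: "'a set set \<Rightarrow> 'a list \<Rightarrow> bool" where
  "is_cycle E c \<longleftrightarrow> 3 \<le> length c \<and> distinct c \<and>
     (\<forall>i < length c. {c ! i, c ! (Suc i mod length c)} \<in> E)"

definition delete_vertices :: "'a set set \<Rightarrow> 'a set \<Rightarrow> 'a set set" where
  "delete_vertices E X = {e \<in> E. e \<inter> X = {}}"

definition FVS :: "nat \<Rightarrow> 'a set \<Rightarrow> 'a set set \<Rightarrow> bool" where
  "FVS k V E \<longleftrightarrow>
     (\<exists>X \<subseteq> V. finite X \<and> card X \<le> k \<and> \<not> (\<exists>c. is_cycle (delete_vertices E X) c))"

definition edge_stream :: "'a set \<Rightarrow> 'a set list \<Rightarrow> bool" where
  "edge_stream V es \<longleftrightarrow> distinct es \<and> set es \<subseteq> all_edges V"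

text \<open>A randomized one-pass algorithm whose memory is a bit string. A sample point of
  \<open>coins\<close> fixes the outcome of all coin tosses. The \<open>nat\<close> argument is the number of edges
  read so far, so that every update (and the answer) can use fresh coins; it also allows
  randomness shared between the steps. Neither the coins nor this counter is charged to the
  space, and a deterministic algorithm is one that ignores the coins.\<close>

record 'w streaming_alg =
  coins :: "'w measure"
  init_mem :: "'w \<Rightarrow> bool list"
  update :: "'w \<Rightarrow> nat \<Rightarrow> bool list \<Rightarrow> nat set \<Rightarrow> bool list"
  answer :: "'w \<Rightarrow> nat \<Rightarrow> bool list \<Rightarrow> bool"

primrec run_from ::
  "'w streaming_alg \<Rightarrow> 'w \<Rightarrow> nat \<Rightarrow> bool list \<Rightarrow> nat set list \<Rightarrow> bool list" where
  "run_from A w t m [] = m"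
| "run_from A w t m (e # es) = run_from A w (Suc t) (update A w t m e) es"

definition memory_after :: "'w streaming_alg \<Rightarrow> 'w \<Rightarrow> nat set list \<Rightarrow> bool list" where
  "memory_after A w es = run_from A w 0 (init_mem A w) es"

definition output_after :: "'w streaming_alg \<Rightarrow> 'w \<Rightarrow> nat set list \<Rightarrow> bool" where
  "output_after A w es = answer A w (length es) (memory_after A w es)"

text \<open>Worst-case number of memory bits on graphs with vertex set \<open>{..<n}\<close>. Prefixes of
  streams are streams, so this accounts for the memory at every point of the pass.\<close>

definition bits_used :: "'w streaming_alg \<Rightarrow> nat \<Rightarrow> enat" where
  "bits_used A n =
     (SUP es \<in> {es. edge_stream {..<n} es}. SUP w \<in> space (coins A).
        enat (length (memory_after A w es)))"

text \<open>\<open>A n\<close> is the algorithm run on graphs with \<open>n\<close> vertices; it may depend on \<open>n\<close> and \<open>k\<close>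
  in an arbitrary way. For \<open>p > 0\<close> the last condition forces the event to be measurable,
  since \<open>measure\<close> is \<open>0\<close> on sets outside the \<open>\<sigma>\<close>-algebra.\<close>

definition is_PSA_for_FVS :: "real \<Rightarrow> nat \<Rightarrow> (nat \<Rightarrow> 'w streaming_alg) \<Rightarrow> bool" where
  "is_PSA_for_FVS p k A \<longleftrightarrow>
     (\<forall>n. prob_space (coins (A n)) \<and>
       (\<forall>es. edge_stream {..<n} es \<longrightarrow>
          p \<le> measure (coins (A n))
            {w \<in> space (coins (A n)). output_after (A n) w es \<longleftrightarrow> FVS k {..<n} (set es)}))"

end

theory Submission
  imports Defs "HOL-Probability.Hoeffding"
begin

text \<open>
  A PSA solves the one-way communication problem INDEX. Alice holds a set \<open>X \<subseteq> {..<m}\<close>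
  and streams, for each \<open>j < m\<close>, the edge from \<open>j\<close> to a hub \<open>m\<close> if \<open>j \<in> X\<close> and to a hub
  \<open>m + 1\<close> otherwise; exactly \<open>m\<close> edges are streamed, so the uncharged edge counter reveals nothing.
  Bob, asking whether \<open>i \<in> X\<close>, appends the path \<open>i, m + 2, m\<close>, which closes a triangle iff
  \<open>i \<in> X\<close>, and \<open>k\<close> disjoint triangles, which use up the budget \<open>k\<close>.

  By averaging, some coin outcome answers a fraction \<open>p = 1/2 + \<delta>\<close> of all pairs \<open>(X, i)\<close>
  correctly. For a fixed memory content, the number of correct answers for a uniformly random \<open>X\<close>
  is binomially distributed with parameters \<open>m\<close> and \<open>1/2\<close>, so its exponential moment is small;
  summing this over all memory contents shows that there are at least \<open>exp (2 * \<delta>\<^sup>2 * m)\<close> of them.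
\<close>

section \<open>The INDEX problem\<close>

text \<open>This is Hoeffding's lemma for a fair sign: with success probability 1/2 and argument
  \<open>2 * x\<close>, the logarithm there is that of \<open>exp x * cosh x\<close>. Negative
  \<open>x\<close> follow because \<open>cosh\<close> is even.\<close>

lemma cosh_le_exp_half_square: "cosh x \<le> exp (x\<^sup>2 / 2)" for x :: real
proof -
  have *: "cosh x \<le> exp (x\<^sup>2 / 2)" if "x \<ge> 0" for x :: real
  proof -
    have "1 + 1/2 * (exp (2 * x) - 1) = exp x * cosh x"
      by (simp add: cosh_field_def field_simps flip: exp_add)
    then have "ln (cosh x) \<le> x\<^sup>2 / 2"
      using Hoeffdings_lemma_aux[of "2 * x" "1/2"] that
      by (simp add: ln_mult power_mult_distrib)
    then show ?thesis
      by (metis cosh_real_pos exp_le_cancel_iff exp_ln)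
  qed
  show ?thesis
    using *[of x] *[of "-x"] by (cases "x \<ge> 0") auto
qed

text \<open>The exponential factors over \<open>I\<close>. For each \<open>i\<close>, membership and
  non-membership contribute \<open>exp l\<close> and \<open>exp (- l)\<close> in some order, so the
  guess \<open>d\<close> does not influence the sum.\<close>

lemma sum_Pow_exp_agreement:
  fixes l :: real
  assumes "finite I"
  shows "(\<Sum>X\<in>Pow I. exp (\<Sum>i\<in>I. if d i \<longleftrightarrow> i \<in> X then l else - l)) = (2 * cosh l) ^ card I"
proof -
  define f where "f i = exp (if d i then l else - l)" for i
  define g where "g i = exp (if d i then - l else l)" for i
  have "exp (\<Sum>i\<in>I. if d i \<longleftrightarrow> i \<in> X then l else - l) = prod f X * prod g (I - X)"
    if "X \<in> Pow I" for X
  proof -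
    have "exp (\<Sum>i\<in>I. if d i \<longleftrightarrow> i \<in> X then l else - l) = (\<Prod>i\<in>I. if i \<in> X then f i else g i)"
      using assms by (auto simp: exp_sum f_def g_def intro!: prod.cong)
    also have "\<dots> = prod f X * prod g (I - X)"
      using that assms by (subst prod.If_cases) (auto simp: Int_absorb1 Diff_eq)
    finally show ?thesis .
  qed
  then have "(\<Sum>X\<in>Pow I. exp (\<Sum>i\<in>I. if d i \<longleftrightarrow> i \<in> X then l else - l)) = (\<Prod>i\<in>I. f i + g i)"
    using assms by (simp add: prod_add)
  also have "\<dots> = (\<Prod>i\<in>I. 2 * cosh l)"
    by (intro prod.cong) (auto simp: f_def g_def cosh_field_def)
  finally show ?thesis by simp
qed

theorem index_lower_bound:
  fixes enc :: "'a set \<Rightarrow> 'b" and dec :: "'b \<Rightarrow> 'a \<Rightarrow> bool" and \<delta> :: real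
  assumes "finite I" "finite M" "enc ` Pow I \<subseteq> M" "\<delta> \<ge> 0"
    and correct: "(1/2 + \<delta>) * (2 ^ card I * card I)
      \<le> (\<Sum>X\<in>Pow I. \<Sum>i\<in>I. of_bool (dec (enc X) i \<longleftrightarrow> i \<in> X))"
  shows "exp (2 * \<delta>\<^sup>2 * card I) \<le> card M"
proof -
  define m where "m = real (card I)"
  \<comment> \<open>This choice maximises the exponent
    \<open>2 * l * \<delta> - l\<^sup>2 / 2\<close> per index that the argument yields; the maximum
    is \<open>2 * \<delta>\<^sup>2\<close>.\<close>
  define l where "l = 2 * \<delta>"
  \<comment> \<open>The score \<open>s\<close> is \<open>l\<close> times the surplus of right over
    wrong answers; \<open>a\<close> is its average when a fraction \<open>1/2 + \<delta>\<close> is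
    right.\<close>
  define a where "a = 2 * l * \<delta> * m"
  define s where "s \<mu> X = (\<Sum>i\<in>I. if dec \<mu> i \<longleftrightarrow> i \<in> X then l else - l)" for \<mu> X
  have s_eq: "s \<mu> X = 2 * l * (\<Sum>i\<in>I. of_bool (dec \<mu> i \<longleftrightarrow> i \<in> X)) - l * m" for \<mu> X
  proof -
    have "s \<mu> X = (\<Sum>i\<in>I. 2 * l * of_bool (dec \<mu> i \<longleftrightarrow> i \<in> X) - l)"
      unfolding s_def by (intro sum.cong) auto
    then show ?thesis by (simp add: sum_subtractf m_def flip: sum_distrib_left)
  qed
  have card_Pow: "real (card (Pow I)) = 2 ^ card I"
    using \<open>finite I\<close> by (simp add: card_Pow)
  have "2 ^ card I * a = 2 * l * ((1/2 + \<delta>) * (2 ^ card I * m)) - 2 ^ card I * (l * m)"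
    by (simp add: a_def algebra_simps)
  also have "\<dots> \<le> 2 * l * (\<Sum>X\<in>Pow I. \<Sum>i\<in>I. of_bool (dec (enc X) i \<longleftrightarrow> i \<in> X))
      - 2 ^ card I * (l * m)"
    using correct \<open>\<delta> \<ge> 0\<close> unfolding m_def l_def by (intro diff_right_mono mult_left_mono) auto
  also have "\<dots> = (\<Sum>X\<in>Pow I. s (enc X) X)"
    by (simp add: s_eq sum_subtractf card_Pow flip: sum_distrib_left)
  finally have avg: "2 ^ card I * a \<le> (\<Sum>X\<in>Pow I. s (enc X) X)" .

  \<comment> \<open>Jensen's inequality for \<open>exp\<close>, via the tangent at \<open>a\<close>.\<close>
  have "2 ^ card I * exp a \<le> exp a * (2 ^ card I + ((\<Sum>X\<in>Pow I. s (enc X) X) - 2 ^ card I * a))"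
    using avg by (simp add: mult.commute)
  also have "\<dots> = (\<Sum>X\<in>Pow I. exp a * (1 + (s (enc X) X - a)))"
    by (simp add: sum.distrib sum_subtractf card_Pow flip: sum_distrib_left)
  also have "\<dots> \<le> (\<Sum>X\<in>Pow I. exp (s (enc X) X))"
  proof (intro sum_mono)
    fix X
    have "exp a * (1 + (s (enc X) X - a)) \<le> exp a * exp (s (enc X) X - a)"
      by (intro mult_left_mono exp_ge_add_one_self) auto
    then show "exp a * (1 + (s (enc X) X - a)) \<le> exp (s (enc X) X)"
      by (simp flip: exp_add)
  qed
  \<comment> \<open>Replacing \<open>enc X\<close> by a sum over all messages decouples the message
    from \<open>X\<close>; after the swap each inner sum has a fixed guess.\<close>
  also have "\<dots> \<le> (\<Sum>X\<in>Pow I. \<Sum>\<mu>\<in>M. exp (s \<mu> X))"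
    using assms(2,3) by (intro sum_mono member_le_sum) auto
  also have "\<dots> = (\<Sum>\<mu>\<in>M. \<Sum>X\<in>Pow I. exp (s \<mu> X))"
    by (rule sum.swap)
  also have "\<dots> = card M * (2 * cosh l) ^ card I"
    using sum_Pow_exp_agreement[OF \<open>finite I\<close>] by (simp add: s_def)
  also have "\<dots> \<le> card M * (2 * exp (l\<^sup>2 / 2)) ^ card I"
    by (intro mult_left_mono power_mono cosh_le_exp_half_square) auto
  also have "\<dots> = 2 ^ card I * (card M * exp (l\<^sup>2 / 2 * m))"
    by (simp add: power_mult_distrib m_def mult.commute flip: exp_of_nat_mult)
  finally have "exp a \<le> card M * exp (l\<^sup>2 / 2 * m)"
    by simp
  moreover have "exp a = exp (2 * \<delta>\<^sup>2 * m) * exp (l\<^sup>2 / 2 * m)"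
    by (simp add: a_def l_def power2_eq_square algebra_simps flip: exp_add)
  ultimately show ?thesis
    by (simp add: m_def)
qed

section \<open>Feedback vertex sets\<close>

text \<open>At a vertex of minimal rank on a cycle, both neighbours would have to be its parent, but
  they differ since a cycle has length at least 3.\<close>

lemma acyclic_if_unique_later_neighbour:
  fixes rank :: "'a \<Rightarrow> nat"
  assumes parent: "\<And>v u. {v, u} \<in> E \<Longrightarrow> rank v \<le> rank u \<Longrightarrow> u = parent v"
  shows "\<not> is_cycle E c"
proof
  assume c: "is_cycle E c"
  define L where "L = length c"
  have L: "L \<ge> 3" and dist: "distinct c" and edge: "\<And>i. i < L \<Longrightarrow> {c ! i, c ! (Suc i mod L)} \<in> E"
    using c by (auto simp: is_cycle_def L_def)
  obtain i where i: "i < L" and min: "\<And>j. j < L \<Longrightarrow> rank (c ! i) \<le> rank (c ! j)"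
    using ex_has_least_nat[of "\<lambda>i. i < L" 0 "\<lambda>i. rank (c ! i)"] L by auto
  \<comment> \<open>The cyclic predecessor of \<open>i\<close>.\<close>
  define j where "j = (if i = 0 then L - 1 else i - 1)"
  have j: "j < L" "Suc j mod L = i" "Suc i mod L < L" "Suc i mod L \<noteq> j"
    using i L by (auto simp: j_def mod_Suc)
  have "c ! (Suc i mod L) = parent (c ! i)" "c ! j = parent (c ! i)"
    using edge[OF i] edge[OF j(1)] min j by (auto intro!: parent simp: insert_commute)
  with j dist show False
    by (metis L_def nth_eq_iff_index_eq)
qed

text \<open>A feedback vertex set meets each of the \<open>k + 1\<close> cycles, and by disjointness
  in different vertices.\<close>

lemma not_FVS_if_disjoint_cycles:
  assumes cyc: "\<And>l. l \<le> k \<Longrightarrow> is_cycle E (c l)"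
    and disj: "\<And>l l'. l \<le> k \<Longrightarrow> l' \<le> k \<Longrightarrow> l \<noteq> l' \<Longrightarrow> set (c l) \<inter> set (c l') = {}"
  shows "\<not> FVS k V E"
proof
  assume "FVS k V E"
  then obtain X where X: "finite X" "card X \<le> k" "\<And>c. \<not> is_cycle (delete_vertices E X) c"
    by (auto simp: FVS_def)
  have "\<exists>x. x \<in> X \<inter> set (c l)" if l: "l \<le> k" for l
  proof (rule ccontr)
    assume "\<not> ?thesis"
    then have *: "c l ! i \<notin> X" if "i < length (c l)" for i
      using that by auto
    have "Suc i mod length (c l) < length (c l)" if "i < length (c l)" for i
      using that by (intro mod_less_divisor) auto
    with * cyc[OF l] have "is_cycle (delete_vertices E X) (c l)"
      by (auto simp: is_cycle_def delete_vertices_def)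
    with X(3) show False by blast
  qed
  then obtain f where f: "\<And>l. l \<le> k \<Longrightarrow> f l \<in> X \<inter> set (c l)"
    by metis
  have "inj_on f {..k}"
    using f disj by (intro inj_onI) (metis IntD2 IntI atMost_iff empty_iff)
  then have "card {..k} \<le> card X"
    using f X(1) by (intro card_inj_on_le[of f]) auto
  with X(2) show False by simp
qed

section \<open>The reduction from INDEX\<close>

definition triangle_edges :: "nat \<Rightarrow> nat set set" where
  "triangle_edges b = {{b, b + 1}, {b + 1, b + 2}, {b + 2, b}}"

definition index_stream :: "nat \<Rightarrow> nat set \<Rightarrow> nat set list" where
  "index_stream m X = map (\<lambda>j. if j \<in> X then {j, m} else {j, m + 1}) [0..<m]"

text \<open>The vertices from \<open>m + 3\<close> on are cut into \<open>k\<close> blocks of three,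
  so \<open>m + 3 + 3 * k\<close> vertices suffice.\<close>

definition query_edges :: "nat \<Rightarrow> nat \<Rightarrow> nat \<Rightarrow> nat set set" where
  "query_edges k m i = {{i, m + 2}, {m + 2, m}} \<union> (\<Union>l<k. triangle_edges (m + 3 + 3 * l))"

lemma doubleton_in_all_edges_iff: "{u, v} \<in> all_edges V \<longleftrightarrow> u \<in> V \<and> v \<in> V \<and> u \<noteq> v"
  by (auto simp: all_edges_def doubleton_eq_iff)

lemma is_cycle_triangle:
  assumes "{a, b} \<in> E" "{b, c} \<in> E" "{c, a} \<in> E" "a \<noteq> b" "b \<noteq> c" "c \<noteq> a"
  shows "is_cycle E [a, b, c]"
proof -
  have "{[a, b, c] ! i, [a, b, c] ! (Suc i mod 3)} \<in> E" if "i < 3" for i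
  proof -
    from that consider "i = 0" | "i = 1" | "i = 2" by linarith
    then show ?thesis using assms(1-3) by cases (simp_all add: numeral_2_eq_2)
  qed
  then show ?thesis
    using assms(4-6) by (simp add: is_cycle_def)
qed

text \<open>No edge is repeated across the two halves: every query edge has an endpoint of at least
  \<open>m + 2\<close>, whereas the first half stays within \<open>{..m + 1}\<close>.\<close>

lemma edge_stream_index_query:
  assumes "i < m" "m + 3 + 3 * k \<le> n" "distinct qs" "set qs = query_edges k m i"
  shows "edge_stream {..<n} (index_stream m X @ qs)"
proof -
  have "distinct (index_stream m X)"
    by (auto simp: index_stream_def distinct_map inj_on_def doubleton_eq_iff split: if_splits)
  moreover have "set (index_stream m X) \<inter> query_edges k m i = {}"
  proof -
    have "e \<subseteq> {..m + 1}" if "e \<in> set (index_stream m X)" for e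
      using that by (auto simp: index_stream_def split: if_splits)
    moreover have "\<not> e \<subseteq> {..m + 1}" if "e \<in> query_edges k m i" for e
      using that by (auto simp: query_edges_def triangle_edges_def)
    ultimately show ?thesis by blast
  qed
  moreover have "set (index_stream m X) \<subseteq> all_edges {..<n}"
    using assms(2) by (auto simp: index_stream_def doubleton_in_all_edges_iff)
  moreover have "query_edges k m i \<subseteq> all_edges {..<n}"
    using assms(1,2) by (auto simp: query_edges_def triangle_edges_def doubleton_in_all_edges_iff)
  ultimately show ?thesis
    using assms(3,4) by (auto simp: edge_stream_def)
qed

text \<open>If \<open>i \<in> X\<close>, there are \<open>k + 1\<close> disjoint triangles.
  Otherwise deleting the first vertex of each of the \<open>k\<close> extra triangles leaves a
  forest.\<close>

lemma FVS_index_query_iff: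
  assumes "i < m" "m + 3 + 3 * k \<le> n"
  shows "FVS k {..<n} (set (index_stream m X) \<union> query_edges k m i) \<longleftrightarrow> i \<notin> X"
proof -
  define E where "E = set (index_stream m X) \<union> query_edges k m i"
  have "FVS k {..<n} E \<longleftrightarrow> i \<notin> X"
  proof
    assume fvs: "FVS k {..<n} E"
    show "i \<notin> X"
    proof
      assume "i \<in> X"
      define c where "c l = (if l = k then [i, m + 2, m]
        else [m + 3 + 3 * l, m + 3 + 3 * l + 1, m + 3 + 3 * l + 2])" for l
      have "{m, i} \<in> set (index_stream m X)"
        using \<open>i \<in> X\<close> assms(1) by (force simp: index_stream_def)
      then have hub: "is_cycle E [i, m + 2, m]"
        using assms(1) by (intro is_cycle_triangle) (auto simp: E_def query_edges_def)
      have triangle: "is_cycle E [b, b + 1, b + 2]" if "triangle_edges b \<subseteq> E" for b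
        using that by (intro is_cycle_triangle) (auto simp: triangle_edges_def)
      have "is_cycle E (c l)" if "l \<le> k" for l
      proof (cases "l = k")
        case False
        then have "triangle_edges (m + 3 + 3 * l) \<subseteq> E"
          using that by (auto simp: E_def query_edges_def)
        from triangle[OF this] False show ?thesis by (simp only: c_def if_False)
      qed (use hub in \<open>simp add: c_def\<close>)
      moreover have "set (c l) \<inter> set (c l') = {}" if "l \<noteq> l'" for l l'
        using that assms(1) by (auto simp: c_def)
      ultimately have "\<not> FVS k {..<n} E"
        using not_FVS_if_disjoint_cycles[of k E c] by blast
      with fvs show False by contradiction
    qed
  next
    assume "i \<notin> X"
    define S where "S = (\<lambda>l. m + 3 + 3 * l) ` {..<k}"
    \<comment> \<open>What remains is the tree with spine \<open>m + 1, i, m + 2, m\<close>, oriented towards \<open>m\<close>, with all other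
      \<open>j < m\<close> as leaves, plus one edge per triangle.\<close>
    define rank :: "nat \<Rightarrow> nat" where "rank v = (if v = i then 2 else if v = m + 1 then 1
      else if v = m + 2 then 3 else if v = m then 4 else 0)" for v
    define parent where "parent v = (if v = i then m + 2 else if v = m + 1 then i
      else if v = m + 2 then m else if v < m then (if v \<in> X then m else m + 1)
      else if (v - m) mod 3 = 1 then v + 1 else v - 1)" for v
    have "\<not> is_cycle (delete_vertices E S) c" for c
    proof (rule acyclic_if_unique_later_neighbour[where rank = rank and parent = parent])
      fix v u
      assume "{v, u} \<in> delete_vertices E S" and le: "rank v \<le> rank u"
      then have vu: "{v, u} \<in> E" "v \<notin> S" "u \<notin> S"
        by (auto simp: delete_vertices_def)
      then consider (index) j where "j < m" "{v, u} = {j, if j \<in> X then m else m + 1}"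
        | (path) "{v, u} = {i, m + 2} \<or> {v, u} = {m + 2, m}"
        | (triangle) l where "l < k" "{v, u} \<in> triangle_edges (m + 3 + 3 * l)"
        by (auto simp: E_def index_stream_def query_edges_def)
      then show "u = parent v"
      proof cases
        case index
        then have "v = j \<and> u = (if j \<in> X then m else m + 1) \<or> u = j \<and> v = (if j \<in> X then m else m + 1)"
          by (auto simp only: doubleton_eq_iff)
        then show ?thesis
          using le index(1) \<open>i \<notin> X\<close> assms(1)
          by (elim disjE conjE) (auto simp: rank_def parent_def split: if_splits)
      next
        case path
        then show ?thesis
          using le assms(1) by (auto simp: doubleton_eq_iff rank_def parent_def split: if_splits)
      next
        case triangle
        then have "m + 3 + 3 * l \<in> S" by (simp add: S_def)
        then have "v \<noteq> m + 3 + 3 * l" "u \<noteq> m + 3 + 3 * l"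
          using vu by auto
        then have "v = m + 4 + 3 * l \<and> u = m + 5 + 3 * l \<or> u = m + 4 + 3 * l \<and> v = m + 5 + 3 * l"
          using triangle(2) by (auto simp: triangle_edges_def doubleton_eq_iff)
        \<comment> \<open>Both endpoints have rank 0, so each must be the parent of the other; the
          residues 1 and 2 of \<open>v - m\<close> modulo 3 tell them apart.\<close>
        then show ?thesis
          using assms(1) by (auto simp: parent_def)
      qed
    qed
    moreover have "S \<subseteq> {..<n}" "finite S"
      using assms(2) by (auto simp: S_def)
    moreover have "card S \<le> k"
      unfolding S_def using card_image_le[of "{..<k}"] by fastforce
    ultimately show "FVS k {..<n} E"
      by (auto simp: FVS_def)
  qed
  then show ?thesis by (simp add: E_def)
qed

section \<open>The space bound\<close>

lemma run_from_append:
  "run_from A w t m (xs @ ys) = run_from A w (t + length xs) (run_from A w t m xs) ys"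
  by (induction xs arbitrary: t m) auto

text \<open>The expected number of \<open>j\<close> for which \<open>P j\<close> holds is at least
  \<open>p * card J\<close>, so some outcome attains this. Measurability comes from
  \<open>p > 0\<close>, since sets that are not events have measure 0.\<close>

lemma (in prob_space) averaging:
  fixes p :: real
  assumes "finite J" "p > 0" "\<And>j. j \<in> J \<Longrightarrow> p \<le> prob {w \<in> space M. P j w}"
  obtains w where "w \<in> space M" "p * card J \<le> (\<Sum>j\<in>J. of_bool (P j w))"
proof -
  have meas: "{w \<in> space M. P j w} \<in> events" if "j \<in> J" for j
    using assms(2) assms(3)[OF that] measure_notin_sets by fastforce
  define f where "f w = (\<Sum>j\<in>J. indicator {w \<in> space M. P j w} w :: real)" for w
  have int: "integrable M f"
    unfolding f_def using meas by (auto simp: emeasure_eq_measure)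
  have "\<exists>w\<in>space M. p * card J \<le> f w"
  proof (rule ccontr)
    assume "\<not> ?thesis"
    then have "expectation f < p * card J"
      using int by (intro expectation_less) (auto simp: not_le)
    also have "p * card J \<le> (\<Sum>j\<in>J. prob {w \<in> space M. P j w})"
      using sum_mono[of J "\<lambda>_. p"] assms(3) by (simp add: mult.commute)
    also have "\<dots> = expectation f"
      unfolding f_def using meas
      by (subst Bochner_Integration.integral_sum) (auto simp: emeasure_eq_measure)
    finally show False by simp
  qed
  then show ?thesis
    using that by (auto simp: f_def indicator_def of_bool_def)
qed

lemma memory_length_le:
  assumes "bits_used A n = enat s" "edge_stream {..<n} es" "w \<in> space (coins A)"
  shows "length (memory_after A w es) \<le> s"
proof -
  have "enat (length (memory_after A w es)) \<le> bits_used A n"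
    unfolding bits_used_def using assms(2,3) by (auto intro!: SUP_upper2)
  with assms(1) show ?thesis by simp
qed

lemma card_bool_lists_le: "card {xs :: bool list. length xs \<le> s} \<le> 2 ^ Suc s"
proof -
  have "card {xs :: bool list. length xs \<le> s} = (\<Sum>i\<le>s. 2 ^ i)"
    using card_lists_length_le[of "UNIV :: bool set" s] by simp
  also have "\<dots> \<le> 2 ^ Suc s"
    by (induction s) auto
  finally show ?thesis .
qed

lemma PSA_space_lower_bound:
  fixes A :: "nat \<Rightarrow> 'w streaming_alg"
  assumes "1 / 2 < p" "is_PSA_for_FVS p k A" "bits_used (A n) n = enat s" "m + 3 + 3 * k \<le> n"
  shows "2 * (p - 1/2)\<^sup>2 * m \<le> s + 1"
proof -
  define \<Omega> where "\<Omega> = coins (A n)"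
  interpret prob_space \<Omega>
    using assms(2) by (simp add: is_PSA_for_FVS_def \<Omega>_def)
  define I where "I = {..<m}"
  have "\<exists>qs. distinct qs \<and> set qs = query_edges k m i" for i
    using finite_distinct_list[of "query_edges k m i"]
    by (auto simp: query_edges_def triangle_edges_def)
  then obtain qs where qs: "\<And>i. distinct (qs i)" "\<And>i. set (qs i) = query_edges k m i"
    by metis
  have stream: "edge_stream {..<n} (index_stream m X @ qs i)" if "i < m" for X i
    using edge_stream_index_query[OF that assms(4) qs] .
  define P where "P = (\<lambda>(X, i) w. output_after (A n) w (index_stream m X @ qs i) \<longleftrightarrow> i \<notin> X)"
  have "p \<le> prob {w \<in> space \<Omega>. P j w}" if j_in: "j \<in> Pow I \<times> I" for j
  proof -
    obtain X i where j: "j = (X, i)" "i < m"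
      using j_in by (auto simp: I_def)
    have "FVS k {..<n} (set (index_stream m X @ qs i)) \<longleftrightarrow> i \<notin> X"
      using FVS_index_query_iff[OF j(2) assms(4)] qs by simp
    moreover have "p \<le> measure (coins (A n)) {w \<in> space (coins (A n)).
        output_after (A n) w (index_stream m X @ qs i)
          \<longleftrightarrow> FVS k {..<n} (set (index_stream m X @ qs i))}"
      using assms(2) stream[OF j(2)] by (simp only: is_PSA_for_FVS_def)
    ultimately show ?thesis
      by (simp only: P_def \<Omega>_def j(1) case_prod_conv)
  qed
  then obtain w where w: "w \<in> space \<Omega>"
    and avg: "p * card (Pow I \<times> I) \<le> (\<Sum>j\<in>Pow I \<times> I. of_bool (P j w))"
    using averaging[of "Pow I \<times> I" p P] assms(1) by (auto simp: I_def)
  define enc where "enc X = memory_after (A n) w (index_stream m X)" for X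
  \<comment> \<open>With the coins fixed to \<open>w\<close>, the rest of the pass is a function of
    the memory and the query alone, resumed at counter \<open>m\<close>. The negation reflects that
    \<open>FVS\<close> holds iff \<open>i \<notin> X\<close>.\<close>
  define dec where "dec \<mu> i \<longleftrightarrow> \<not> answer (A n) w (m + length (qs i)) (run_from (A n) w m \<mu> (qs i))"
    for \<mu> i
  have P_iff: "P (X, i) w \<longleftrightarrow> (dec (enc X) i \<longleftrightarrow> i \<in> X)" for X i
    by (auto simp: P_def dec_def enc_def output_after_def memory_after_def run_from_append
        index_stream_def)
  \<comment> \<open>For \<open>m > 0\<close> there is a query, here 0, and the first half is a
    prefix of the resulting valid stream; \<open>m = 0\<close> makes the final bound
    trivial.\<close>
  have "length (enc X) \<le> s" if "m > 0" for X
    unfolding enc_def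
  proof (rule memory_length_le[OF assms(3)])
    show "edge_stream {..<n} (index_stream m X)"
      using stream[OF that, of X] by (auto simp: edge_stream_def)
  qed (use w in \<open>simp add: \<Omega>_def\<close>)
  moreover have "finite {xs :: bool list. length xs \<le> s}"
    using finite_lists_length_le[of "UNIV :: bool set" s] by simp
  moreover have "(1/2 + (p - 1/2)) * (2 ^ card I * card I)
      \<le> (\<Sum>X\<in>Pow I. \<Sum>i\<in>I. of_bool (dec (enc X) i \<longleftrightarrow> i \<in> X))"
    using avg by (simp add: sum.cartesian_product' card_Pow I_def P_iff flip: of_nat_sum)
  ultimately have "exp (2 * (p - 1/2)\<^sup>2 * m) \<le> card {xs :: bool list. length xs \<le> s}" if "m > 0"
    using index_lower_bound[of I "{xs. length xs \<le> s}" enc "p - 1/2" dec] assms(1) that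
    by (auto simp: I_def)
  also have "real (card {xs :: bool list. length xs \<le> s}) \<le> 2 ^ Suc s"
    using card_bool_lists_le[of s] by (metis of_nat_le_iff of_nat_numeral of_nat_power)
  \<comment> \<open>Passing from base 2 to base \<open>exp 1\<close> only weakens the constant and
    lets the exponents be compared directly.\<close>
  also have "(2 :: real) ^ Suc s \<le> exp 1 ^ Suc s"
    using exp_ge_add_one_self[of 1] by (intro power_mono) auto
  also have "\<dots> = exp (real s + 1)"
    by (simp add: exp_add mult.commute flip: exp_of_nat_mult)
  finally show ?thesis
    by (cases "m = 0") auto
qed

theorem theorem6:
  fixes A :: "nat \<Rightarrow> 'w streaming_alg" and k :: nat and p :: real
  assumes "1 / 2 < p"
    and "is_PSA_for_FVS p k A"
  shows "\<exists>c::real. c > 0 \<and>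
    (\<forall>\<^sub>F n in sequentially. ereal (c * real n) \<le> ereal_of_enat (bits_used (A n) n))"
proof (intro exI conjI)
  define c where "c = (p - 1/2)\<^sup>2"
  show "c > 0"
    using assms(1) by (simp add: c_def)
  \<comment> \<open>For \<open>n \<ge> N\<close> and \<open>m = n - (3 + 3 * k)\<close> this gives
    \<open>2 * m \<ge> n + 1 / c\<close>: half of the vertices pay for the gadgets, and
    \<open>1 / c\<close> absorbs the \<open>+ 1\<close> in \<open>s + 1\<close>.\<close>
  define N where "N = 2 * (3 + 3 * k) + nat \<lceil>1 / c\<rceil>"
  show "\<forall>\<^sub>F n in sequentially. ereal (c * real n) \<le> ereal_of_enat (bits_used (A n) n)"
  proof (rule eventually_sequentiallyI[of N])
    fix n assume "N \<le> n"
    show "ereal (c * real n) \<le> ereal_of_enat (bits_used (A n) n)"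
    proof (cases "bits_used (A n) n")
      case (enat s)
      define m where "m = n - (3 + 3 * k)"
      have "real N \<ge> 2 * (3 + 3 * real k) + 1 / c"
        unfolding N_def by (simp add: real_nat_ceiling_ge)
      then have "2 * real m \<ge> real n + 1 / c"
        using \<open>N \<le> n\<close> by (simp add: m_def N_def of_nat_diff)
      then have "c * (real n + 1 / c) \<le> c * (2 * real m)"
        using \<open>c > 0\<close> by (intro mult_left_mono) auto
      also have "\<dots> \<le> s + 1"
        using PSA_space_lower_bound[OF assms enat, of m] \<open>N \<le> n\<close>
        by (simp add: m_def N_def c_def algebra_simps)
      finally have "c * real n \<le> s"
        using \<open>c > 0\<close> by (simp add: distrib_left)
      then show ?thesis by (simp add: enat)
    qed simp
  qed
qed

end
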